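(* Let $\{X_n,n\ge 1\}$ be a sequence of random variables. Suppose that $1\leq p<\infty$ and $\sum_{n=1}^{\infty}\|X_n\|_p<\infty$. Then for every $\varepsilon>0$, $$\sum_{n=2}^{\infty}\frac{1}{(\ln n)^{1+\varepsilon}}\left\|\frac{S_n}{n}\right\|_p<\infty .$$
   Context: All random variables are real-valued and defined on a common probability space $(\Omega,\mathcal{F},P)$; no independence is assumed. $E$ denotes expectation, $\|X\|_p=(E[|X|^p])^{1/p}$, and $S_n=\sum_{k=1}^n X_k$ for $n\ge 1$. *)

theory Defs
  imports "HOL-Probability.Probability"
begin

text \<open>
  \<open>(E |f|^p)^(1/p)\<close> as an element of \<open>[0, \<infinity>]\<close>: the expectation is a nonnegative integral and the
  norm is \<open>\<infinity>\<close> when it diverges, so no default value of the Bochner integral enters. The root is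
  spelled out by cases because \<^const>\<open>powr\<close> is not available on \<^typ>\<open>ennreal\<close>.
\<close>
definition Lp_norm :: "'a measure \<Rightarrow> real \<Rightarrow> ('a \<Rightarrow> real) \<Rightarrow> ennreal" where
  "Lp_norm M p f =
    (let I = (\<integral>\<^sup>+ \<omega>. ennreal (\<bar>f \<omega>\<bar> powr p) \<partial>M)
     in if I = \<infinity> then \<infinity> else ennreal (enn2real I powr (1 / p)))"

text \<open>\<open>S_n = X_1 + \<dots> + X_n\<close>; the value \<open>X 0\<close> is never used.\<close>
definition partial_sum :: "(nat \<Rightarrow> 'a \<Rightarrow> real) \<Rightarrow> nat \<Rightarrow> 'a \<Rightarrow> real" where
  "partial_sum X n \<omega> = (\<Sum>k = 1..n. X k \<omega>)"

end

theory Submission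
  imports Defs
begin

text \<open>
  By Minkowski's inequality the norms of the partial sums are bounded by \<open>C = \<Sum>\<parallel>X\<^sub>n\<parallel>\<^sub>p\<close>, so the
  series is dominated by \<open>C\<close> times the Bertrand series with terms \<open>1 / (n (ln n)\<^bsup>1 + \<epsilon>\<^esup>)\<close>.
\<close>

text \<open>Trades a finite bound on the norm for a bound on the \<open>p\<close>-th moment, since
  roots and powers are monotone on nonnegative reals. Later estimates can then work with integrals
  alone, free of the root and of the infinite case.\<close>

lemma Lp_norm_le_iff:
  fixes a p :: real
  assumes "0 < p" "0 \<le> a"
  shows "Lp_norm M p f \<le> ennreal a \<longleftrightarrow> (\<integral>\<^sup>+ \<omega>. ennreal (\<bar>f \<omega>\<bar> powr p) \<partial>M) \<le> ennreal (a powr p)"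
proof (cases "(\<integral>\<^sup>+ \<omega>. ennreal (\<bar>f \<omega>\<bar> powr p) \<partial>M)")
  case top
  then show ?thesis by (simp add: Lp_norm_def top_unique)
next
  case (real r)
  have "r powr (1/p) \<le> a \<longleftrightarrow> r \<le> a powr p"
  proof
    assume "r powr (1/p) \<le> a"
    then have "(r powr (1/p)) powr p \<le> a powr p"
      using assms by (intro powr_mono2) auto
    then show "r \<le> a powr p"
      using assms real by (simp add: powr_powr)
  next
    assume "r \<le> a powr p"
    then have "r powr (1/p) \<le> (a powr p) powr (1/p)"
      using assms real by (intro powr_mono2) auto
    then show "r powr (1/p) \<le> a"
      using assms by (simp add: powr_powr)
  qed
  then show ?thesis
    using real assms by (simp add: Lp_norm_def ennreal_le_iff)
qed

lemma Lp_norm_cmult_le: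
  fixes a c p :: real
  assumes "0 < p" "0 \<le> a" "0 \<le> c" and [measurable]: "f \<in> borel_measurable M"
    and "Lp_norm M p f \<le> ennreal a"
  shows "Lp_norm M p (\<lambda>\<omega>. c * f \<omega>) \<le> ennreal (c * a)"
proof -
  have "(\<integral>\<^sup>+ \<omega>. ennreal (\<bar>c * f \<omega>\<bar> powr p) \<partial>M) = (\<integral>\<^sup>+ \<omega>. ennreal (c powr p) * ennreal (\<bar>f \<omega>\<bar> powr p) \<partial>M)"
    using assms by (simp add: abs_mult powr_mult ennreal_mult)
  also have "\<dots> = ennreal (c powr p) * (\<integral>\<^sup>+ \<omega>. ennreal (\<bar>f \<omega>\<bar> powr p) \<partial>M)"
    by (rule nn_integral_cmult) measurable
  also have "\<dots> \<le> ennreal (c powr p) * ennreal (a powr p)"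
    using assms by (intro mult_left_mono) (auto simp: Lp_norm_le_iff)
  also have "\<dots> = ennreal ((c * a) powr p)"
    using assms by (simp add: powr_mult ennreal_mult)
  finally show ?thesis
    using assms by (simp add: Lp_norm_le_iff)
qed

text \<open>\<open>powr_convex\<close> settles strictly positive points; what has to be added is the
  endpoint 0, which matters because random variables may vanish. If one of the two points is 0,
  convexity reduces to \<open>t powr p \<le> t\<close> for \<open>t\<close> between 0 and 1, which
  holds as \<open>1 \<le> p\<close>.\<close>

lemma convex_on_powr:
  fixes p :: real
  assumes p: "1 \<le> p"
  shows "convex_on {0..} (\<lambda>x. x powr p)"
proof -
  have scale: "(t * z) powr p \<le> t * z powr p" if "0 \<le> t" "t \<le> 1" "0 \<le> z" for t z :: real
  proof -
    have "t powr p \<le> t powr 1"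
      using powr_mono'[OF p] that by simp
    then show ?thesis
      using that by (simp add: powr_mult mult_right_mono)
  qed
  have "(u * x + v * y) powr p \<le> u * x powr p + v * y powr p"
    if "0 \<le> x" "0 \<le> y" "0 \<le> u" "0 \<le> v" "u + v = 1" for x y u v :: real
  proof (cases "x = 0 \<or> y = 0")
    case True
    then show ?thesis
      using scale[of u x] scale[of v y] that p by auto
  next
    case False
    then show ?thesis
      using powr_convex[OF p] that unfolding convex_on_def by auto
  qed
  then show ?thesis
    by (auto simp: convex_on_def)
qed

text \<open>Convexity of \<open>x\<^sup>p\<close>, applied to \<open>|f|/a\<close> and \<open>|g|/b\<close> with weights proportional to \<open>a\<close> and \<open>b\<close>.\<close>
lemma abs_add_powr_le:
  fixes a b p x y :: real
  assumes "1 \<le> p" "0 < a" "0 < b"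
  shows "\<bar>x + y\<bar> powr p \<le>
    (a + b) powr p * (a / (a + b) / a powr p * \<bar>x\<bar> powr p + b / (a + b) / b powr p * \<bar>y\<bar> powr p)"
proof -
  define u v where "u = a / (a + b)" and "v = b / (a + b)"
  have uv: "0 \<le> u" "0 \<le> v" "u + v = 1"
    using assms by (auto simp: u_def v_def add_divide_distrib[symmetric])
  have "\<bar>x + y\<bar> powr p \<le> (\<bar>x\<bar> + \<bar>y\<bar>) powr p"
    using assms by (intro powr_mono2) auto
  also have "\<bar>x\<bar> + \<bar>y\<bar> = (a + b) * (u * (\<bar>x\<bar> / a) + v * (\<bar>y\<bar> / b))"
    using assms by (simp add: u_def v_def distrib_left)
  also have "\<dots> powr p = (a + b) powr p * (u * (\<bar>x\<bar> / a) + v * (\<bar>y\<bar> / b)) powr p"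
    by (rule powr_mult)
  also have "\<dots> \<le> (a + b) powr p * (u * (\<bar>x\<bar> / a) powr p + v * (\<bar>y\<bar> / b) powr p)"
  proof (rule mult_left_mono)
    have "\<bar>x\<bar> / a \<in> {0..}" "\<bar>y\<bar> / b \<in> {0..}"
      using assms by auto
    then show "(u * (\<bar>x\<bar> / a) + v * (\<bar>y\<bar> / b)) powr p \<le> u * (\<bar>x\<bar> / a) powr p + v * (\<bar>y\<bar> / b) powr p"
      using convex_on_powr[OF assms(1)] uv unfolding convex_on_def real_scaleR_def by blast
  qed simp
  finally show ?thesis
    using assms by (simp add: u_def v_def powr_divide)
qed

text \<open>Minkowski's inequality for upper bounds instead of the norms themselves: integrate the
  pointwise convexity estimate and insert the moment bounds \<open>a powr p\<close> and
  \<open>b powr p\<close>. Strict positivity allows the normalization by \<open>a\<close> and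
  \<open>b\<close>.\<close>

lemma Lp_norm_add_le_pos:
  fixes a b p :: real
  assumes p: "1 \<le> p" and ab: "0 < a" "0 < b"
    and [measurable]: "f \<in> borel_measurable M" "g \<in> borel_measurable M"
    and fg: "Lp_norm M p f \<le> ennreal a" "Lp_norm M p g \<le> ennreal b"
  shows "Lp_norm M p (\<lambda>\<omega>. f \<omega> + g \<omega>) \<le> ennreal (a + b)"
proof -
  define u v where "u = a / (a + b) / a powr p" and "v = b / (a + b) / b powr p"
  have uv: "0 \<le> u" "0 \<le> v"
    using ab by (auto simp: u_def v_def)
  have "(\<integral>\<^sup>+ \<omega>. ennreal (\<bar>f \<omega> + g \<omega>\<bar> powr p) \<partial>M) \<le>
     (\<integral>\<^sup>+ \<omega>. ennreal ((a + b) powr p) *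
       (ennreal u * ennreal (\<bar>f \<omega>\<bar> powr p) + ennreal v * ennreal (\<bar>g \<omega>\<bar> powr p)) \<partial>M)"
    using uv abs_add_powr_le[OF p ab, folded u_def v_def]
    by (intro nn_integral_mono)
       (simp add: ennreal_mult[symmetric] ennreal_plus[symmetric] ennreal_leI del: ennreal_plus)
  also have "\<dots> = ennreal ((a + b) powr p) *
      (ennreal u * (\<integral>\<^sup>+ \<omega>. ennreal (\<bar>f \<omega>\<bar> powr p) \<partial>M) + ennreal v * (\<integral>\<^sup>+ \<omega>. ennreal (\<bar>g \<omega>\<bar> powr p) \<partial>M))"
    by (simp add: nn_integral_cmult nn_integral_add)
  also have "\<dots> \<le> ennreal ((a + b) powr p) *
      (ennreal u * ennreal (a powr p) + ennreal v * ennreal (b powr p))"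
    using p ab fg by (intro mult_left_mono add_mono) (auto simp: Lp_norm_le_iff)
  also have "\<dots> = ennreal ((a + b) powr p * (u * a powr p + v * b powr p))"
    using uv by (simp add: ennreal_mult)
  \<comment> \<open>The moment bounds cancel the normalizing denominators, leaving the convex
    weights \<open>a / (a + b)\<close> and \<open>b / (a + b)\<close>.\<close>
  also have "u * a powr p + v * b powr p = 1"
    using ab by (simp add: u_def v_def add_divide_distrib[symmetric])
  finally show ?thesis
    using p ab by (simp add: Lp_norm_le_iff del: ennreal_plus)
qed

lemma Lp_norm_triangle:
  fixes p :: real
  assumes p: "1 \<le> p" and m: "f \<in> borel_measurable M" "g \<in> borel_measurable M"
  shows "Lp_norm M p (\<lambda>\<omega>. f \<omega> + g \<omega>) \<le> Lp_norm M p f + Lp_norm M p g"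
proof (rule ennreal_le_epsilon)
  fix e :: real
  assume fin: "Lp_norm M p f + Lp_norm M p g < top" and e: "0 < e"
  obtain a b where ab: "0 \<le> a" "0 \<le> b" "Lp_norm M p f = ennreal a" "Lp_norm M p g = ennreal b"
    using fin by (cases "Lp_norm M p f"; cases "Lp_norm M p g") auto
  \<comment> \<open>Adding \<open>e/2\<close> to each norm makes both bounds strictly positive, so a
    vanishing norm needs no separate case.\<close>
  have "Lp_norm M p (\<lambda>\<omega>. f \<omega> + g \<omega>) \<le> ennreal ((a + e/2) + (b + e/2))"
    using ab e by (intro Lp_norm_add_le_pos[OF p _ _ m]) (auto intro!: ennreal_leI)
  also have "\<dots> = Lp_norm M p f + Lp_norm M p g + ennreal e"
    using ab e by (simp add: ennreal_plus[symmetric] del: ennreal_plus)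
  finally show "Lp_norm M p (\<lambda>\<omega>. f \<omega> + g \<omega>) \<le> Lp_norm M p f + Lp_norm M p g + ennreal e" .
qed

lemma borel_measurable_partial_sum:
  assumes "\<And>n. 1 \<le> n \<Longrightarrow> X n \<in> borel_measurable M"
  shows "partial_sum X n \<in> borel_measurable M"
  unfolding partial_sum_def[abs_def] using assms by (intro borel_measurable_sum) auto

lemma Lp_norm_partial_sum_le:
  fixes p :: real
  assumes p: "1 \<le> p" and X: "\<And>n. 1 \<le> n \<Longrightarrow> X n \<in> borel_measurable M"
  shows "Lp_norm M p (partial_sum X n) \<le> (\<Sum>k<n. Lp_norm M p (X (k + 1)))"
proof (induction n)
  case 0
  then show ?case
    using p by (simp add: Lp_norm_def partial_sum_def)
next
  case (Suc n)
  have "Lp_norm M p (partial_sum X (Suc n)) = Lp_norm M p (\<lambda>\<omega>. partial_sum X n \<omega> + X (Suc n) \<omega>)"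
    by (simp add: partial_sum_def[abs_def])
  also have "\<dots> \<le> Lp_norm M p (partial_sum X n) + Lp_norm M p (X (Suc n))"
    using p X by (intro Lp_norm_triangle borel_measurable_partial_sum) auto
  also have "\<dots> \<le> (\<Sum>k<Suc n. Lp_norm M p (X (k + 1)))"
    using Suc.IH by (simp add: add_right_mono)
  finally show ?case .
qed

text \<open>Cauchy condensation; the shift in the logarithm makes the terms monotone from \<open>n = 1\<close> on.\<close>
lemma summable_inverse_ln_powr:
  fixes s :: real
  assumes "1 < s"
  shows "summable (\<lambda>n. 1 / (real n * ln (real (n + 1)) powr s))"
proof -
  let ?f = "\<lambda>n. 1 / (real n * ln (real (n + 1)) powr s)"
  \<comment> \<open>The factor \<open>2 ^ n\<close> cancels the linear factor of
    \<open>?f (2 ^ n)\<close>, and \<open>ln (2 ^ n + 1) \<ge> n * ln 2\<close> leaves a multiple of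
    the series of \<open>n powr (-s)\<close>, convergent for \<open>s > 1\<close>.\<close>
  have "summable (\<lambda>n. 2 ^ n * ?f (2 ^ n))"
  proof (rule summable_comparison_test_ev)
    show "summable (\<lambda>n. ln 2 powr (-s) * real n powr (-s))"
      using assms by (intro summable_mult) (simp add: summable_real_powr_iff)
    show "\<forall>\<^sub>F n in sequentially. norm (2 ^ n * ?f (2 ^ n)) \<le> ln 2 powr (-s) * real n powr (-s)"
    \<comment> \<open>At \<open>n = 0\<close> the comparison fails: \<open>0 powr (-s)\<close> is 0
      while the condensed term is positive.\<close>
    proof (rule eventually_sequentiallyI[of 1])
      fix n :: nat
      assume n: "1 \<le> n"
      have "real n * ln 2 = ln (2 ^ n)"
        by (simp add: ln_realpow)
      also have "\<dots> \<le> ln (real (2 ^ n + 1))"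
        by (subst ln_le_cancel_iff) (auto intro: add_pos_pos)
      finally have "(real n * ln 2) powr s \<le> ln (real (2 ^ n + 1)) powr s"
        using assms by (intro powr_mono2) auto
      moreover have "0 < (real n * ln 2) powr s"
        using n by simp
      ultimately have "1 / ln (real (2 ^ n + 1)) powr s \<le> 1 / (real n * ln 2) powr s"
        by (intro divide_left_mono mult_pos_pos) linarith+
      then show "norm (2 ^ n * ?f (2 ^ n)) \<le> ln 2 powr (-s) * real n powr (-s)"
        by (simp add: powr_mult powr_minus_divide mult.commute)
    qed
  qed
  \<comment> \<open>Division by zero gives \<open>?f 0 = 0\<close>, so monotonicity can start only
    at 1. Without the shift in the logarithm, \<open>ln 1 = 0\<close> would spoil the term at 1 in
    the same way.\<close>
  moreover have "?f (Suc m) \<le> ?f m" if "0 < m" for m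
  proof -
    have "ln (real (m + 1)) powr s \<le> ln (real (Suc m + 1)) powr s"
      using assms by (intro powr_mono2) auto
    with that show ?thesis
      by (intro divide_left_mono mult_mono mult_pos_pos) auto
  qed
  ultimately show ?thesis
    by (subst condensation_test) auto
qed

theorem proposition3p7:
  fixes M :: "'a measure" and X :: "nat \<Rightarrow> 'a \<Rightarrow> real" and p :: real
  assumes "prob_space M"
    and "\<And>n. 1 \<le> n \<Longrightarrow> X n \<in> borel_measurable M"
    and "1 \<le> p"
    and "(\<Sum>n. Lp_norm M p (X (n + 1))) < \<infinity>"
  shows "\<forall>\<epsilon>::real. 0 < \<epsilon> \<longrightarrow>
    (\<Sum>n. ennreal (1 / (ln (real (n + 2)) powr (1 + \<epsilon>)))
          * Lp_norm M p (\<lambda>\<omega>. partial_sum X (n + 2) \<omega> / real (n + 2))) < \<infinity>"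
proof (intro allI impI)
  fix \<epsilon> :: real
  assume \<epsilon>: "0 < \<epsilon>"
  obtain C where C: "0 \<le> C" "(\<Sum>n. Lp_norm M p (X (n + 1))) = ennreal C"
    using assms(4) by (cases "(\<Sum>n. Lp_norm M p (X (n + 1)))") auto
  have S: "Lp_norm M p (partial_sum X n) \<le> ennreal C" for n
  proof -
    have "Lp_norm M p (partial_sum X n) \<le> (\<Sum>k<n. Lp_norm M p (X (k + 1)))"
      by (rule Lp_norm_partial_sum_le[OF assms(3)]) (rule assms(2))
    also have "\<dots> \<le> (\<Sum>k. Lp_norm M p (X (k + 1)))"
      by (rule sum_le_suminf) auto
    finally show ?thesis
      by (simp only: C)
  qed
  \<comment> \<open>This is the shifted Bertrand term at index \<open>n + 1\<close>, chosen so that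
    its logarithm \<open>ln (n + 2)\<close> is exactly the one in the target series.\<close>
  define g where "g n = C * (1 / (real (n + 1) * ln (real (n + 1 + 1)) powr (1 + \<epsilon>)))" for n
  have "summable g"
    unfolding g_def using summable_inverse_ln_powr[of "1 + \<epsilon>"] \<epsilon>
    by (intro summable_mult summable_ignore_initial_segment[where k = 1]) simp
  moreover have "0 \<le> g n" for n
    using C by (simp add: g_def)
  ultimately have fin: "(\<Sum>n. ennreal (g n)) < \<infinity>"
    by (simp add: suminf_ennreal2)
  have "(\<Sum>n. ennreal (1 / (ln (real (n + 2)) powr (1 + \<epsilon>)))
          * Lp_norm M p (\<lambda>\<omega>. partial_sum X (n + 2) \<omega> / real (n + 2))) \<le> (\<Sum>n. ennreal (g n))"
  proof (rule suminf_le)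
    fix n
    have "Lp_norm M p (\<lambda>\<omega>. 1 / real (n + 2) * partial_sum X (n + 2) \<omega>) \<le> ennreal (1 / real (n + 2) * C)"
      using assms(2,3) C S by (intro Lp_norm_cmult_le borel_measurable_partial_sum) auto
    \<comment> \<open>The logarithms already agree, so only the linear factor is weakened, from
      \<open>n + 2\<close> to the \<open>n + 1\<close> occurring in \<open>g\<close>.\<close>
    also have "\<dots> \<le> ennreal (1 / real (n + 1) * C)"
      using C by (intro ennreal_leI mult_right_mono divide_left_mono) auto
    finally have "ennreal (1 / (ln (real (n + 2)) powr (1 + \<epsilon>)))
          * Lp_norm M p (\<lambda>\<omega>. partial_sum X (n + 2) \<omega> / real (n + 2))
        \<le> ennreal (1 / (ln (real (n + 2)) powr (1 + \<epsilon>))) * ennreal (1 / real (n + 1) * C)"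
      by (intro mult_left_mono) auto
    also have "\<dots> = ennreal (g n)"
      using C by (subst ennreal_mult[symmetric]) (auto simp: g_def add.commute mult.commute)
    finally show "ennreal (1 / (ln (real (n + 2)) powr (1 + \<epsilon>)))
          * Lp_norm M p (\<lambda>\<omega>. partial_sum X (n + 2) \<omega> / real (n + 2)) \<le> ennreal (g n)" .
  qed auto
  also note fin
  finally show "(\<Sum>n. ennreal (1 / (ln (real (n + 2)) powr (1 + \<epsilon>)))
          * Lp_norm M p (\<lambda>\<omega>. partial_sum X (n + 2) \<omega> / real (n + 2))) < \<infinity>" .
qed

end
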